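(* Let $n\ge 2$ and $1\le d\le n-1$ be integers, and let $L\subseteq\mathbb{R}^n$ be a compact convex set. Then $L$ is $d$-reliable if and only if every simplicial family, each of whose members is the unit normal to $L$ at some regular boundary point of $L$, has size at most $d+1$.
   Context: All compact convex sets are nonempty. For a linear subspace $\xi$ of $\mathbb{R}^n$, $K_\xi$ denotes the orthogonal projection of $K$ onto $\xi$. For $1\le d\le n-1$, a compact convex set $L\subseteq\mathbb{R}^n$ is $d$-reliable (a $d$-reliable cover) if, for every compact convex $K\subseteq\mathbb{R}^n$ such that $L_\xi$ contains a translate of $K_\xi$ for every $d$-dimensional linear subspace $\xi\subseteq\mathbb{R}^n$, the set $L$ contains a translate of $K$. A set of unit vectors $\{u_0,\dots,u_k\}\subseteq\mathbb{R}^n$ is a $k$-simplicial family if $u_0,\dots,u_k$ span a $k$-dimensional subspace and there exist real numbers $c_0,\dots,c_k>0$ with $c_0u_0+\cdots+c_ku_k=o$ (the origin). A $k$-simplicial family has exactly $k+1$ elements, and its size is $k+1$. A simplicial family is a $k$-simplicial family for some $k\ge1$. Boundary and normals of $L$ are taken relative to the affine hull of $L$: let $V$ be the linear subspace parallel to the affine hull of $L$ (so $V=\mathbb{R}^n$ if $L$ has nonempty interior). A point $x$ of the (relative) boundary of $L$ is regular if the outward normal cone $\{u\in V : u\cdot(y-x)\le 0 \text{ for all } y\in L\}$ contains exactly one unit vector; that vector is the unit normal to $L$ at $x$. *)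

theory Defs
  imports "HOL-Analysis.Analysis"
begin

definition proj_onto :: "'a::euclidean_space set \<Rightarrow> 'a set \<Rightarrow> 'a set" where
  "proj_onto \<xi> K = {y \<in> \<xi>. \<exists>x\<in>K. \<forall>z\<in>\<xi>. orthogonal (x - y) z}"

definition contains_translate :: "'a::euclidean_space set \<Rightarrow> 'a set \<Rightarrow> bool" where
  "contains_translate L K \<longleftrightarrow> (\<exists>t. (\<lambda>x. t + x) ` K \<subseteq> L)"

definition reliable :: "nat \<Rightarrow> 'a::euclidean_space set \<Rightarrow> bool" where
  "reliable d L \<longleftrightarrow>
     (\<forall>K. compact K \<and> convex K \<and> K \<noteq> {} \<and>
          (\<forall>\<xi>. subspace \<xi> \<and> dim \<xi> = d \<longrightarrow>
               contains_translate (proj_onto \<xi> L) (proj_onto \<xi> K))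
        \<longrightarrow> contains_translate L K)"

(* The index set {0, ..., k} is replaced by the family itself, whose members are
   pairwise distinct because it has exactly k + 1 elements. *)
definition k_simplicial_family :: "nat \<Rightarrow> 'a::euclidean_space set \<Rightarrow> bool" where
  "k_simplicial_family k U \<longleftrightarrow>
     finite U \<and> card U = k + 1 \<and> (\<forall>u\<in>U. norm u = 1) \<and> dim (span U) = k \<and>
     (\<exists>c. (\<forall>u\<in>U. c u > 0) \<and> (\<Sum>u\<in>U. c u *\<^sub>R u) = 0)"

definition simplicial_family :: "'a::euclidean_space set \<Rightarrow> bool" where
  "simplicial_family U \<longleftrightarrow> (\<exists>k\<ge>1. k_simplicial_family k U)"

definition direction_space :: "'a::euclidean_space set \<Rightarrow> 'a set" where
  "direction_space L = {x - y | x y. x \<in> affine hull L \<and> y \<in> affine hull L}"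

definition normal_cone :: "'a::euclidean_space set \<Rightarrow> 'a \<Rightarrow> 'a set" where
  "normal_cone L x = {u \<in> direction_space L. \<forall>y\<in>L. u \<bullet> (y - x) \<le> 0}"

definition regular_point :: "'a::euclidean_space set \<Rightarrow> 'a \<Rightarrow> bool" where
  "regular_point L x \<longleftrightarrow>
     x \<in> rel_frontier L \<and> (\<exists>!u. u \<in> normal_cone L x \<and> norm u = 1)"

definition unit_normal_at :: "'a::euclidean_space set \<Rightarrow> 'a \<Rightarrow> 'a \<Rightarrow> bool" where
  "unit_normal_at L x u \<longleftrightarrow> regular_point L x \<and> u \<in> normal_cone L x \<and> norm u = 1"

lemma proj_onto_closest_point:
  assumes "subspace \<xi>"
  shows "proj_onto \<xi> K = closest_point \<xi> ` K"
proof -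
  have cl: "closed \<xi>" "\<xi> \<noteq> {}" "convex \<xi>"
    using assms closed_subspace subspace_imp_convex subspace_0 by blast+
  have orth: "orthogonal (x - closest_point \<xi> x) z" if "z \<in> \<xi>" for x z
  proof -
    let ?p = "closest_point \<xi> x"
    have p: "?p \<in> \<xi>" using cl closest_point_in_set by blast
    have "(x - ?p) \<bullet> ((?p + z) - ?p) \<le> 0" "(x - ?p) \<bullet> ((?p - z) - ?p) \<le> 0"
      using closest_point_dot[OF cl(3) cl(1)] p that assms
      by (blast intro: subspace_add subspace_diff)+
    then show ?thesis by (simp add: orthogonal_def)
  qed
  have "y = closest_point \<xi> x" if "y \<in> \<xi>" "\<forall>z\<in>\<xi>. orthogonal (x - y) z" for x y
  proof -
    let ?w = "closest_point \<xi> x - y"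
    have w: "?w \<in> \<xi>"
      using that(1) cl closest_point_in_set assms by (blast intro: subspace_diff)
    have "?w \<bullet> ?w = (x - y) \<bullet> ?w - (x - closest_point \<xi> x) \<bullet> ?w"
      by (simp add: inner_diff_left)
    also have "\<dots> = 0"
      using that(2) w orth by (simp add: orthogonal_def)
    finally show ?thesis by simp
  qed
  then show ?thesis
    unfolding proj_onto_def using orth cl closest_point_in_set by blast
qed

lemma direction_space_parallel:
  assumes "L \<noteq> {}"
  shows "subspace (direction_space L)" "affine_parallel (direction_space L) (affine hull L)"
proof -
  obtain a where a: "a \<in> affine hull L"
    using assms hull_inc by (metis ex_in_conv)
  define V where "V = (\<lambda>x. (- a) + x) ` (affine hull L)"
  have V: "subspace V"
    unfolding V_def using a affine_affine_hull affine_diffs_subspace by blast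
  have "direction_space L = V"
  proof
    show "direction_space L \<subseteq> V"
    proof
      fix v assume "v \<in> direction_space L"
      then obtain x y where xy: "v = x - y" "x \<in> affine hull L" "y \<in> affine hull L"
        unfolding direction_space_def by blast
      then have "(- a + x) - (- a + y) \<in> V"
        using V unfolding V_def by (intro subspace_diff) auto
      then show "v \<in> V" using xy by simp
    qed
    show "V \<subseteq> direction_space L"
      unfolding V_def direction_space_def using a by force
  qed
  moreover have "affine_parallel V (affine hull L)"
    unfolding affine_parallel_def V_def by (rule exI[of _ a]) (simp add: image_image)
  ultimately show "subspace (direction_space L)"
    "affine_parallel (direction_space L) (affine hull L)"
    using V by simp_all
qed

end

theory Submission
  imports Defs
begin

text \<open>
  A compact convex set is cut out of its affine hull by the half-spaces belonging to its regular
  unit normals \<open>u\<close>, so \<open>t + K \<subseteq> L\<close> is the linear system \<open>u \<bullet> t \<le> h\<^sub>L(u) - h\<^sub>K(u)\<close>. By compactness and Farkas'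
  lemma, infeasibility is witnessed by finitely many normals, and a witness of minimal support is a
  simplicial family \<open>U\<close>. If \<open>U\<close> has at most \<open>d + 1\<close> elements, it lies in a \<open>d\<close>-dimensional subspace \<open>\<xi>\<close>, where
  the containment of the projections contradicts the witness.

  Conversely, let \<open>U\<close> be a simplicial family of regular normals spanning a space of dimension
  greater than \<open>d\<close>, let \<open>x\<^sub>u\<close> be the corresponding boundary points, and let \<open>K\<close> be the convex hull of
  the \<open>x\<^sub>u\<close>, dilated by a factor \<open>1 + \<epsilon>\<close> about a relative interior point of \<open>L\<close>. No translate of \<open>K\<close>
  lies in \<open>L\<close>. If for every \<open>\<epsilon>\<close> some \<open>d\<close>-dimensional projection of \<open>K\<close> did not fit, separation would
  give dual vectors in that subspace; in the limit \<open>\<epsilon> \<rightarrow> 0\<close> they become nonnegative multiples of the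
  members of \<open>U\<close> with sum zero, hence all of them positive, which forces \<open>U\<close> into a space of
  dimension at most \<open>d\<close>.
\<close>

section \<open>Farkas' lemma with a witness of minimal support\<close>

lemma subspace_orthogonal_decomp:
  fixes V :: "'a::euclidean_space set"
  assumes "subspace V"
  obtains y z where "y \<in> V" "\<And>w. w \<in> V \<Longrightarrow> w \<bullet> z = 0" "x = y + z"
  using orthogonal_subspace_decomp_exists[of V x] assms
  by (metis inner_commute orthogonal_def span_eq_iff)

text \<open>The ratio test of linear programming: moving from \<open>c\<close> along
  \<open>- b\<close>, the smallest quotient \<open>c u / b u\<close> over the \<open>u\<close> with
  \<open>b u > 0\<close> is where a first weight vanishes.\<close>

lemma shrink_positive_weights:
  fixes c b :: "'a::real_vector \<Rightarrow> real"
  assumes "finite U" and c: "\<And>u. u \<in> U \<Longrightarrow> c u > 0"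
    and "w \<in> U" "b w > 0"
  obtains l where "l > 0" "\<And>u. u \<in> U \<Longrightarrow> c u - l * b u \<ge> 0" "\<exists>u\<in>U. c u - l * b u = 0"
proof -
  let ?P = "{u \<in> U. b u > 0}"
  let ?R = "(\<lambda>u. c u / b u) ` ?P"
  have fin: "finite ?R" "?R \<noteq> {}" using assms by auto
  define l where "l = Min ?R"
  have "l \<in> ?R" unfolding l_def using fin by (rule Min_in)
  then obtain v where v: "v \<in> U" "b v > 0" "l = c v / b v" by auto
  have lpos: "l > 0" using v c by simp
  have "c u - l * b u \<ge> 0" if "u \<in> U" for u
  proof (cases "b u > 0")
    case True
    then have "l \<le> c u / b u" unfolding l_def using that fin by (intro Min_le) auto
    then show ?thesis using True by (simp add: pos_le_divide_eq)
  next
    case False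
    then have "l * b u \<le> 0" using lpos by (simp add: mult_nonneg_nonpos)
    then show ?thesis using c[OF that] by linarith
  qed
  moreover have "c v - l * b v = 0" using v by simp
  ultimately show ?thesis using that lpos v(1) by blast
qed

text \<open>The witness exists as soon as \<open>(0,-1)\<close> lies in the cone generated by
  \<open>(0,1)\<close> and the pairs \<open>(u, g u)\<close>. This cone is finitely generated, hence
  closed; a functional \<open>(t,s)\<close> separating \<open>(0,-1)\<close> from it would give the
  solution \<open>- t /\<^sub>R s\<close>.\<close>

lemma farkas_cone:
  fixes g :: "'a::euclidean_space \<Rightarrow> real"
  assumes "finite F" and inf: "\<nexists>t. \<forall>u\<in>F. u \<bullet> t \<le> g u"
  shows "\<exists>c. (\<forall>u\<in>F. c u \<ge> 0) \<and> (\<Sum>u\<in>F. c u *\<^sub>R u) = 0 \<and> (\<Sum>u\<in>F. c u * g u) < 0"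
proof -
  let ?S = "insert (0::'a, 1::real) ((\<lambda>u. (u, g u)) ` F)"
  let ?C = "convex_cone hull ?S"
  let ?E = "{(\<Sum>u\<in>F. c u *\<^sub>R u, (\<Sum>u\<in>F. c u * g u) + s) | c s. (\<forall>u\<in>F. c u \<ge> 0) \<and> s \<ge> (0::real)}"
  have cl: "closed ?C" using assms by (intro closed_convex_cone_hull) auto
  have conv: "convex ?C" by (rule convex_convex_cone_hull)
  have E: "?C \<subseteq> ?E"
  proof (rule hull_minimal)
    show "?S \<subseteq> ?E"
    proof
      fix p assume "p \<in> ?S"
      then consider "p = (0,1)" | u where "u \<in> F" "p = (u, g u)" by auto
      then show "p \<in> ?E"
      proof cases
        case 1
        then show ?thesis by (auto intro!: exI[of _ "\<lambda>_. 0"])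
      next
        case 2
        have "(\<Sum>v\<in>F. (if v = u then 1 else 0) *\<^sub>R v) = u"
          using 2 assms(1) by (simp add: if_distrib [of "\<lambda>r. r *\<^sub>R _"] cong: if_cong)
        moreover have "(\<Sum>v\<in>F. (if v = u then 1 else 0) * g v) = g u"
          using 2 assms(1) by (simp add: if_distrib [of "\<lambda>r. r * _"] cong: if_cong)
        ultimately show ?thesis using 2
          by (auto intro!: exI[of _ "\<lambda>v. if v = u then 1 else 0"] exI[of _ 0])
      qed
    qed
    show "convex_cone ?E"
      unfolding convex_cone_iff
    proof (intro conjI ballI allI impI)
      show "0 \<in> ?E" by (auto simp: zero_prod_def intro!: exI[of _ "\<lambda>_. 0"] exI[of _ 0])
    next
      fix x y assume "x \<in> ?E" "y \<in> ?E"
      then obtain a r b s where *: "x = (\<Sum>u\<in>F. a u *\<^sub>R u, (\<Sum>u\<in>F. a u * g u) + r)"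
        "y = (\<Sum>u\<in>F. b u *\<^sub>R u, (\<Sum>u\<in>F. b u * g u) + s)"
        "\<forall>u\<in>F. a u \<ge> 0" "\<forall>u\<in>F. b u \<ge> 0" "r \<ge> 0" "s \<ge> 0" by auto
      then show "x + y \<in> ?E"
        by (auto intro!: exI[of _ "\<lambda>u. a u + b u"] exI[of _ "r + s"]
              simp: algebra_simps sum.distrib)
    next
      fix x and l :: real assume "x \<in> ?E" "0 \<le> l"
      then obtain a r where *: "x = (\<Sum>u\<in>F. a u *\<^sub>R u, (\<Sum>u\<in>F. a u * g u) + r)"
        "\<forall>u\<in>F. a u \<ge> 0" "r \<ge> 0" "l \<ge> 0" by auto
      then show "l *\<^sub>R x \<in> ?E"
        by (auto intro!: exI[of _ "\<lambda>u. l * a u"] exI[of _ "l * r"]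
              simp: algebra_simps sum_distrib_left scaleR_sum_right)
    qed
  qed
  have "(0,-1) \<in> ?C"
  proof (rule ccontr)
    assume "(0,-1) \<notin> ?C"
    then obtain n b where sep: "n \<bullet> (0,-1) < b" "\<forall>x\<in>?C. n \<bullet> x > b"
      using separating_hyperplane_closed_point[OF conv cl] by blast
    obtain t s where n: "n = (t,s)" by force
    have "b < 0" using sep(2) convex_cone_hull_contains_0 by force
    \<comment> \<open>A point of the cone with negative value could be scaled until its value is
      exactly \<open>b\<close>, but all values exceed \<open>b\<close>.\<close>
    have nn: "n \<bullet> x \<ge> 0" if "x \<in> ?C" for x
    proof (rule ccontr)
      assume "\<not> n \<bullet> x \<ge> 0"
      then have neg: "n \<bullet> x < 0" by simp
      then have "(b / (n \<bullet> x)) *\<^sub>R x \<in> ?C" using that \<open>b < 0\<close>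
        by (intro convex_cone_hull_mul) (auto simp: divide_nonpos_neg)
      then have "n \<bullet> ((b / (n \<bullet> x)) *\<^sub>R x) > b" using sep(2) by blast
      then show False using neg by simp
    qed
    have "s \<noteq> 0" "s \<ge> 0"
      using sep(1) \<open>b < 0\<close> nn[of "(0,1)"] by (auto simp: n hull_inc)
    then have s: "s > 0" by simp
    have "u \<bullet> (- t /\<^sub>R s) \<le> g u" if "u \<in> F" for u
    proof -
      have "t \<bullet> u + s * g u \<ge> 0" using nn[of "(u, g u)"] that by (simp add: n hull_inc)
      then show ?thesis using s by (simp add: inner_commute field_simps)
    qed
    then show False using inf by blast
  qed
  then have "(0,-1) \<in> ?E" using E by blast
  then obtain c s where "0 = (\<Sum>u\<in>F. c u *\<^sub>R u)" "-1 = (\<Sum>u\<in>F. c u * g u) + s"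
    "\<forall>u\<in>F. c u \<ge> 0" "s \<ge> 0" by auto
  then show ?thesis by (intro exI[of _ c]) auto
qed

text \<open>The set \<open>U - {w}\<close> is independent: a relation on it, extended by 0 at
  \<open>w\<close>, is a multiple of \<open>c\<close> that vanishes at \<open>w\<close>, where
  \<open>c\<close> does not. Since \<open>c\<close> expresses \<open>w\<close> through the rest,
  dropping \<open>w\<close> keeps the span.\<close>

lemma dim_circuit:
  fixes U :: "'a::euclidean_space set"
  assumes "finite U" "w \<in> U" "c w \<noteq> 0" "(\<Sum>u\<in>U. c u *\<^sub>R u) = 0"
    and uniq: "\<And>b. (\<Sum>u\<in>U. b u *\<^sub>R u) = 0 \<Longrightarrow> \<exists>l. \<forall>u\<in>U. b u = l * c u"
  shows "dim (span U) + 1 = card U"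
proof -
  have U: "U = insert w (U - {w})" using assms(2) by blast
  have ind: "independent (U - {w})"
  proof
    assume "dependent (U - {w})"
    then obtain b v where b: "v \<in> U - {w}" "b v \<noteq> 0" "(\<Sum>u\<in>U - {w}. b u *\<^sub>R u) = 0"
      using assms(1) by (subst (asm) dependent_finite) auto
    let ?b = "\<lambda>u. if u = w then 0 else b u"
    have "(\<Sum>u\<in>U. ?b u *\<^sub>R u) = (\<Sum>u\<in>U - {w}. ?b u *\<^sub>R u)"
      using assms(1,2) by (subst sum.remove[of U w]) auto
    also have "\<dots> = 0" unfolding b(3)[symmetric] by (rule sum.cong) auto
    finally obtain l where l: "\<forall>u\<in>U. ?b u = l * c u" using uniq[of ?b] by metis
    have "l = 0" using bspec[OF l assms(2)] assms(3) by simp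
    moreover have "b v = l * c v" using bspec[OF l, of v] b(1) by auto
    ultimately show False using b(2) by simp
  qed
  have w: "(\<Sum>u\<in>U - {w}. (- (c u / c w)) *\<^sub>R u) = w"
  proof -
    have "c w *\<^sub>R w + (\<Sum>u\<in>U - {w}. c u *\<^sub>R u) = 0"
      using assms(4) sum.remove[OF assms(1,2), of "\<lambda>u. c u *\<^sub>R u"] by simp
    then have eq: "(\<Sum>u\<in>U - {w}. c u *\<^sub>R u) = - (c w *\<^sub>R w)"
      by (simp add: eq_neg_iff_add_eq_0 add.commute)
    have "(\<Sum>u\<in>U - {w}. (- (c u / c w)) *\<^sub>R u) = (- 1 / c w) *\<^sub>R (\<Sum>u\<in>U - {w}. c u *\<^sub>R u)"
      by (simp add: scaleR_sum_right sum_negf)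
    then show ?thesis using assms(3) unfolding eq by simp
  qed
  have "(\<Sum>u\<in>U - {w}. (- (c u / c w)) *\<^sub>R u) \<in> span (U - {w})"
    by (intro span_sum span_mul span_base)
  then have "w \<in> span (U - {w})" unfolding w .
  then have "span (insert w (U - {w})) = span (U - {w})" by (rule span_redundant)
  then have "dim (span U) = card (U - {w})"
    using ind unfolding U[symmetric] by (simp add: dim_eq_card_independent)
  then show ?thesis using card.remove[OF assms(1,2)] by simp
qed

text \<open>A witness with support of least cardinality is a circuit, since a second independent
  relation could be used to cancel one of its weights.\<close>

lemma farkas_circuit:
  fixes g :: "'a::euclidean_space \<Rightarrow> real"
  assumes "finite F" and inf: "\<nexists>t. \<forall>u\<in>F. u \<bullet> t \<le> g u"
  shows "\<exists>U c. U \<subseteq> F \<and> (\<forall>u\<in>U. c u > 0) \<and> (\<Sum>u\<in>U. c u *\<^sub>R u) = 0 \<and>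
    (\<Sum>u\<in>U. c u * g u) < 0 \<and> dim (span U) + 1 = card U"
proof -
  define Q where "Q U c \<longleftrightarrow> U \<subseteq> F \<and> (\<forall>u\<in>U. c u > 0) \<and> (\<Sum>u\<in>U. c u *\<^sub>R u) = 0
      \<and> (\<Sum>u\<in>U. c u * g u) < 0" for U c
  have restrict: "Q {u \<in> U. c u > 0} c"
    if "U \<subseteq> F" "\<forall>u\<in>U. c u \<ge> 0" "(\<Sum>u\<in>U. c u *\<^sub>R u) = 0" "(\<Sum>u\<in>U. c u * g u) < 0" for U c
  proof -
    have "finite U" using that(1) assms(1) finite_subset by blast
    then have "(\<Sum>u\<in>{u \<in> U. c u > 0}. c u *\<^sub>R u) = (\<Sum>u\<in>U. c u *\<^sub>R u)"
      "(\<Sum>u\<in>{u \<in> U. c u > 0}. c u * g u) = (\<Sum>u\<in>U. c u * g u)"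
      using that(2) by (auto intro!: sum.mono_neutral_left simp: order.order_iff_strict)
    then show ?thesis using that unfolding Q_def by auto
  qed
  obtain c0 where "\<forall>u\<in>F. c0 u \<ge> 0" "(\<Sum>u\<in>F. c0 u *\<^sub>R u) = 0" "(\<Sum>u\<in>F. c0 u * g u) < 0"
    using farkas_cone[OF assms] by blast
  then have "\<exists>U c. Q U c" using restrict[of F c0] by blast
  then obtain U where "\<exists>c. Q U c" and Umin: "\<And>W. \<exists>c. Q W c \<Longrightarrow> card U \<le> card W"
    using ex_has_least_nat[of "\<lambda>U. \<exists>c. Q U c" _ card] by blast
  then obtain c where Q: "Q U c" by blast
  have UF: "U \<subseteq> F" and c: "\<And>u. u \<in> U \<Longrightarrow> c u > 0" and c0: "(\<Sum>u\<in>U. c u *\<^sub>R u) = 0"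
    and cg: "(\<Sum>u\<in>U. c u * g u) < 0" using Q unfolding Q_def by auto
  have fin: "finite U" using UF assms(1) finite_subset by blast
  obtain w where w: "w \<in> U" using cg by fastforce
  let ?G = "\<lambda>b. \<Sum>u\<in>U. b u * g u"
  \<comment> \<open>A relation \<open>b\<close> orthogonal to \<open>g\<close> with a positive entry
    could be subtracted from \<open>c\<close> until a weight vanishes; the negative value survives
    on a smaller support, against minimality.\<close>
  have nopos: "b u \<le> 0" if "u \<in> U" "(\<Sum>u\<in>U. b u *\<^sub>R u) = 0" "?G b = 0" for b u
  proof (rule ccontr)
    assume "\<not> b u \<le> 0"
    then have "b u > 0" by simp
    obtain l where l: "l > 0" "\<And>u. u \<in> U \<Longrightarrow> c u - l * b u \<ge> 0" "\<exists>u\<in>U. c u - l * b u = 0"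
      using shrink_positive_weights[where U=U and c=c and b=b and w=u] fin c \<open>u \<in> U\<close> \<open>b u > 0\<close>
      by blast
    let ?c = "\<lambda>u. c u - l * b u"
    have "(\<Sum>u\<in>U. ?c u *\<^sub>R u) = (\<Sum>u\<in>U. c u *\<^sub>R u) - l *\<^sub>R (\<Sum>u\<in>U. b u *\<^sub>R u)"
      by (simp add: scaleR_diff_left sum_subtractf scaleR_sum_right)
    moreover have "(\<Sum>u\<in>U. ?c u * g u) = ?G c - l * ?G b"
      by (simp add: left_diff_distrib sum_subtractf sum_distrib_left mult.assoc)
    ultimately have "Q {u \<in> U. ?c u > 0} ?c"
      using that UF c0 cg l(2) by (intro restrict) auto
    then have "card U \<le> card {u \<in> U. ?c u > 0}" using Umin by blast
    moreover have "{u \<in> U. ?c u > 0} \<subset> U" using l(3) by force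
    ultimately show False using fin by (meson leD psubset_card_mono)
  qed
  have "dim (span U) + 1 = card U"
  proof (rule dim_circuit[OF fin w _ c0])
    show "c w \<noteq> 0" using c[OF w] by simp
    fix b :: "'a \<Rightarrow> real" assume b: "(\<Sum>u\<in>U. b u *\<^sub>R u) = 0"
    \<comment> \<open>Subtracting a multiple of \<open>c\<close> makes \<open>b\<close> orthogonal to \<open>g\<close>, so that moving along it does not
      destroy the strict inequality.\<close>
    define l where "l = ?G b / ?G c"
    let ?b = "\<lambda>u. b u - l * c u"
    have sb: "(\<Sum>u\<in>U. ?b u *\<^sub>R u) = 0"
      using b c0 by (simp add: scaleR_diff_left sum_subtractf flip: scaleR_scaleR scaleR_sum_right)
    have gb: "?G ?b = 0"
      using cg by (simp add: left_diff_distrib sum_subtractf mult.assoc flip: sum_distrib_left) (simp add: l_def)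
    have "?b u = 0" if "u \<in> U" for u
    proof -
      have "?b u \<le> 0" using nopos[OF that sb gb] .
      moreover have "- ?b u \<le> 0"
        using nopos[OF that, of "\<lambda>u. - ?b u"] sb gb
        by (simp add: sum_negf del: minus_diff_eq)
      ultimately show ?thesis by linarith
    qed
    then show "\<exists>l. \<forall>u\<in>U. b u = l * c u" by (intro exI[of _ l]) auto
  qed
  then show ?thesis using UF c c0 cg by blast
qed

section \<open>Infinite systems of linear inequalities by compactness\<close>

text \<open>By \<open>rec\<close> the recession cone of the system in \<open>V\<close> is trivial,
  so finitely many inequalities already bound the solutions in \<open>V\<close>. The others are
  added by the finite intersection property.\<close>

lemma feasible_on_subspace:
  fixes V :: "'a::euclidean_space set"
  assumes V: "subspace V" and N: "N \<subseteq> V"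
    and rec: "\<And>t. t \<in> V \<Longrightarrow> (\<And>u. u \<in> N \<Longrightarrow> u \<bullet> t \<le> 0) \<Longrightarrow> t = 0"
    and fin: "\<And>F. finite F \<Longrightarrow> F \<subseteq> N \<Longrightarrow> \<exists>t. \<forall>u\<in>F. u \<bullet> t \<le> g u"
  shows "\<exists>t\<in>V. \<forall>u\<in>N. u \<bullet> t \<le> g u"
proof -
  have fin': "\<exists>t\<in>V. \<forall>u\<in>F. u \<bullet> t \<le> g u" if F: "finite F" "F \<subseteq> N" for F
  proof -
    obtain t where t: "\<forall>u\<in>F. u \<bullet> t \<le> g u" using fin F by blast
    obtain y z where "y \<in> V" "\<And>w. w \<in> V \<Longrightarrow> w \<bullet> z = 0" "t = y + z"
      using subspace_orthogonal_decomp[OF V, of t] by blast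
    moreover have "u \<bullet> z = 0" if "u \<in> F" for u using that F N \<open>\<And>w. w \<in> V \<Longrightarrow> w \<bullet> z = 0\<close> by blast
    ultimately show ?thesis using t by (intro bexI[of _ y]) (auto simp: inner_add_right)
  qed
  let ?T = "\<lambda>u. {t. u \<bullet> t \<le> g u}"
  let ?K = "sphere 0 1 \<inter> V"
  \<comment> \<open>\<open>?O (u,e)\<close> contains the unit directions along which
    \<open>u\<close> grows at a rate above \<open>e\<close>; the margins \<open>e\<close> of a
    finite subcover turn into a norm bound for \<open>C\<close>.\<close>
  let ?O = "\<lambda>(u,e). {t::'a. u \<bullet> t > e}"
  have cpt: "compact ?K" using V by (simp add: closed_subspace compact_Int_closed)
  have cov: "?K \<subseteq> (\<Union>p\<in>N \<times> {0<..}. ?O p)"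
  proof
    fix t assume t: "t \<in> ?K"
    then have "t \<noteq> 0" by auto
    then obtain u where "u \<in> N" "u \<bullet> t > 0" using rec[of t] t by force
    then show "t \<in> (\<Union>p\<in>N \<times> {0<..}. ?O p)"
      by (intro UN_I[of "(u, (u \<bullet> t) / 2)"]) auto
  qed
  have op: "open (?O p)" for p
    by (cases p) (simp add: open_halfspace_gt)
  obtain D where D: "D \<subseteq> N \<times> {0<..}" "finite D" "?K \<subseteq> (\<Union>p\<in>D. ?O p)"
    by (rule compactE_image[OF cpt op cov])
  let ?F = "fst ` D"
  define C where "C = V \<inter> (\<Inter>u\<in>?F. ?T u)"
  have "closed C"
    unfolding C_def using V by (intro closed_Int closed_INT) (auto simp: closed_subspace closed_halfspace_le)
  moreover have "bounded C"
  proof -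
    define B where "B = (\<Sum>p\<in>D. \<bar>g (fst p)\<bar> / snd p)"
    have "norm t \<le> B" if t: "t \<in> C" for t
    proof (cases "t = 0")
      case True
      then show ?thesis unfolding B_def using D(1) by (auto intro!: sum_nonneg)
    next
      case False
      have "t /\<^sub>R norm t \<in> ?K" using False t V unfolding C_def by (auto simp: subspace_scale)
      then obtain p where p: "p \<in> D" "t /\<^sub>R norm t \<in> ?O p" using D(3) by blast
      then have e: "snd p > 0" and gt: "fst p \<bullet> (t /\<^sub>R norm t) > snd p"
        using D(1) by auto
      have "snd p * norm t < fst p \<bullet> t"
        using gt False by (simp add: field_simps)
      also have "\<dots> \<le> \<bar>g (fst p)\<bar>" using t p(1) unfolding C_def by fastforce
      finally have "norm t \<le> \<bar>g (fst p)\<bar> / snd p" using e by (simp add: field_simps)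
      also have "\<dots> \<le> B"
        unfolding B_def using p(1) D(1,2) by (intro member_le_sum) auto
      finally show ?thesis .
    qed
    then show ?thesis by (auto simp: bounded_iff)
  qed
  ultimately have "compact C" using compact_eq_bounded_closed by blast
  then have "C \<inter> (\<Inter>u\<in>N. ?T u) \<noteq> {}"
  proof (rule compact_imp_fip_image)
    show "closed (?T u)" for u by (rule closed_halfspace_le)
    fix I assume I: "finite I" "I \<subseteq> N"
    have "finite (?F \<union> I)" "?F \<union> I \<subseteq> N" using D(1,2) I by auto
    then obtain t where "t \<in> V" "\<forall>u\<in>?F \<union> I. u \<bullet> t \<le> g u" using fin' by blast
    then have "t \<in> C \<inter> (\<Inter>u\<in>I. ?T u)" unfolding C_def by auto
    then show "C \<inter> (\<Inter>u\<in>I. ?T u) \<noteq> {}" by blast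
  qed
  then show ?thesis unfolding C_def by blast
qed

section \<open>Regular boundary points and the half-spaces of their normals\<close>

lemma add_direction_space:
  assumes "x \<in> affine hull L" "w \<in> direction_space L"
  shows "x + w \<in> affine hull L"
  using assms mem_affine_3_minus[OF affine_affine_hull, of x L _ _ 1]
  unfolding direction_space_def by auto

lemma diff_in_direction_space:
  assumes "x \<in> affine hull L" "y \<in> affine hull L"
  shows "x - y \<in> direction_space L"
  using assms unfolding direction_space_def by blast

text \<open>A supporting functional \<open>b\<close>, strict on the relative interior, is projected
  to the direction space. Its values on differences of points of \<open>L\<close> do not change, so
  strictness keeps the projection nonzero; the sign flips because \<open>b\<close> is minimal at
  \<open>p\<close>.\<close>

lemma unit_normal_exists:
  fixes L :: "'a::euclidean_space set"
  assumes "convex L" "p \<in> L" "p \<notin> rel_interior L"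
  obtains v where "v \<in> normal_cone L p" "norm v = 1"
proof -
  have ne: "L \<noteq> {}" using assms(2) by blast
  obtain b where "b \<noteq> 0" and b: "\<And>y. y \<in> L \<Longrightarrow> b \<bullet> p \<le> b \<bullet> y" "\<And>y. y \<in> rel_interior L \<Longrightarrow> b \<bullet> p < b \<bullet> y"
    by (metis supporting_hyperplane_rel_boundary[OF assms])
  obtain v z where vz: "v \<in> direction_space L" "\<And>w. w \<in> direction_space L \<Longrightarrow> w \<bullet> z = 0"
    "b = v + z"
    by (metis subspace_orthogonal_decomp[OF direction_space_parallel(1)[OF ne], of b])
  have eq: "b \<bullet> (y - p) = v \<bullet> (y - p)" if "y \<in> L" for y
  proof -
    have "(y - p) \<bullet> z = 0"
      using that assms(2) by (intro vz(2) diff_in_direction_space) (auto simp: hull_inc)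
    then show ?thesis by (metis add.right_neutral inner_add_right inner_commute vz(3))
  qed
  obtain o' where o: "o' \<in> rel_interior L" using assms(1) ne rel_interior_eq_empty by blast
  have "v \<bullet> (o' - p) > 0"
    using b(2)[OF o] eq[of o'] o rel_interior_subset by (force simp: inner_diff_right)
  then have "v \<noteq> 0" by auto
  define u where "u = - v /\<^sub>R norm v"
  have "u \<in> direction_space L"
    unfolding u_def using vz(1) direction_space_parallel(1)[OF ne]
    by (intro subspace_scale subspace_neg)
  moreover have "u \<bullet> (y - p) \<le> 0" if "y \<in> L" for y
    using b(1)[OF that] eq[OF that] by (auto simp: u_def inner_diff_right intro!: mult_left_mono)
  moreover have "norm u = 1" using \<open>v \<noteq> 0\<close> by (simp add: u_def)
  ultimately show ?thesis using that unfolding normal_cone_def by blast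
qed

text \<open>A boundary point that is touched by a (relative) ball inside \<open>L\<close> is regular. Moving a small
  ball from the interior towards \<open>q\<close> until it hits the boundary produces such a point.\<close>

lemma regular_normal_separates:
  fixes L :: "'a::euclidean_space set"
  assumes "closed L" "convex L" "L \<noteq> {}" "q \<in> affine hull L" "q \<notin> L"
  obtains x u where "unit_normal_at L x u" "u \<bullet> x < u \<bullet> q"
proof -
  let ?A = "affine hull L"
  obtain a where a: "a \<in> rel_interior L" using assms rel_interior_eq_empty by blast
  then have aL: "a \<in> L" using rel_interior_subset by blast
  obtain r where r: "r > 0" "cball a r \<inter> ?A \<subseteq> L" using a mem_rel_interior_cball by blast
  \<comment> \<open>The distance to \<open>F\<close> tells how large a relative ball around a point
    of the affine hull stays in \<open>L\<close>.\<close>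
  define F where "F = ?A - rel_interior L"
  have clF: "closed F"
    unfolding F_def
    by (metis closed_affine_hull closedin_closed_trans closedin_diff closedin_self openin_rel_interior)
  have qF: "q \<in> F" using assms(4,5) rel_interior_subset unfolding F_def by blast
  define \<delta> where "\<delta> = infdist q L"
  have \<delta>: "\<delta> > 0" unfolding \<delta>_def
    using assms by (metis in_closed_iff_infdist_zero infdist_nonneg order_less_le)
  define D where "D = norm (q - a)"
  have D: "D \<ge> \<delta>" unfolding D_def \<delta>_def using infdist_le[OF aL, of q] by (simp add: dist_norm)
  \<comment> \<open>The final estimate rests on \<open>2 * \<epsilon> \<le> (1 - s) * r\<close>,
    which this choice yields from \<open>\<delta> \<le> (1 - s) * D\<close>, valid because the
    centre \<open>c s\<close> lies in \<open>L\<close>.\<close>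
  define \<epsilon> where "\<epsilon> = r * \<delta> / (2 * D)"
  have eps: "\<epsilon> > 0" "\<epsilon> < r" unfolding \<epsilon>_def using r(1) \<delta> D by (auto simp: field_simps intro: add_pos_pos)
  have fa: "infdist a F \<ge> r"
  proof -
    have "r \<le> dist a y" if "y \<in> F" for y
    proof (rule ccontr)
      assume "\<not> r \<le> dist a y"
      then have "y \<in> ball a r" by simp
      then obtain e where e: "e > 0" "ball y e \<subseteq> ball a r" by (meson open_ball open_contains_ball)
      then have "ball y e \<inter> ?A \<subseteq> L" using r(2) ball_subset_cball by blast
      moreover have "y \<in> ?A" using that unfolding F_def by blast
      ultimately have "y \<in> rel_interior L"
        using e(1) by (subst mem_rel_interior_ball) auto
      then show False using that unfolding F_def by blast
    qed
    then show ?thesis using qF by (auto simp: infdist_def intro: cINF_greatest)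
  qed
  define c where "c s = a + s *\<^sub>R (q - a)" for s :: real
  \<comment> \<open>The distance to \<open>F\<close> is at least \<open>r\<close> at
    \<open>a\<close> and 0 at \<open>q\<close>, so at some centre on the segment the ball of radius
    \<open>\<epsilon>\<close> just touches \<open>F\<close>.\<close>
  have "\<exists>s\<ge>0. s \<le> 1 \<and> infdist (c s) F = \<epsilon>"
  proof (rule IVT2')
    show "continuous_on {0..1} (\<lambda>s. infdist (c s) F)"
      unfolding c_def by (intro continuous_intros)
    show "infdist (c 1) F \<le> \<epsilon>" "\<epsilon> \<le> infdist (c 0) F"
      using qF eps fa by (auto simp: c_def)
  qed auto
  then obtain s where s: "0 \<le> s" "s \<le> 1" and infd: "infdist (c s) F = \<epsilon>" by blast
  have "F \<noteq> {}" using qF by blast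
  from infdist_attains_inf[OF clF this, of "c s"] obtain p where p: "p \<in> F" "dist (c s) p = \<epsilon>"
    unfolding infd by metis
  have aA: "a \<in> ?A" using aL by (rule hull_inc)
  have sub: "subspace (direction_space L)" using assms(3) by (rule direction_space_parallel)
  have cA: "c s \<in> ?A" unfolding c_def
    using aA assms(4) sub by (intro add_direction_space subspace_scale diff_in_direction_space)
  have pA: "p \<in> ?A" using p unfolding F_def by blast
  have ballL: "y \<in> L" if "y \<in> ?A" "dist (c s) y < \<epsilon>" for y
  proof -
    have "y \<notin> F" using that infd infdist_le[of y F "c s"] by force
    then show ?thesis using that rel_interior_subset unfolding F_def by blast
  qed
  have in_ball: "c s + w \<in> L" if "w \<in> direction_space L" "norm w < \<epsilon>" for w
    using that cA by (intro ballL add_direction_space) (auto simp: dist_norm)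
  have npc: "norm (p - c s) = \<epsilon>" using p by (simp add: dist_norm norm_minus_commute)
  have pcd: "p - c s \<in> direction_space L" using pA cA by (rule diff_in_direction_space)
  \<comment> \<open>Only the open ball is known to lie in \<open>L\<close>; \<open>p\<close> is a
    limit of its points on the radius from \<open>c s\<close>, and \<open>L\<close> is
    closed.\<close>
  have pL: "p \<in> L"
  proof -
    have "\<exists>y\<in>L. dist y p < e" if "e > 0" for e
    proof -
      define \<theta> where "\<theta> = min (1/2) (e / (2 * \<epsilon>))"
      have th: "0 < \<theta>" "\<theta> < 1" "\<theta> * \<epsilon> < e" using that eps
        by (auto simp: \<theta>_def min_def field_simps)
      have "c s + (1 - \<theta>) *\<^sub>R (p - c s) \<in> L"
        using th eps pcd sub by (intro in_ball subspace_scale) (auto simp: npc)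
      moreover have "c s + (1 - \<theta>) *\<^sub>R (p - c s) - p = - \<theta> *\<^sub>R (p - c s)"
        by (simp add: algebra_simps)
      then have "dist (c s + (1 - \<theta>) *\<^sub>R (p - c s)) p = \<theta> * \<epsilon>"
        using th by (simp add: dist_norm npc)
      ultimately show ?thesis using th(3) by metis
    qed
    then show ?thesis using assms(1) by (metis closure_approachable closure_closed)
  qed
  have pni: "p \<notin> rel_interior L" using p unfolding F_def by blast
  define u where "u = (p - c s) /\<^sub>R \<epsilon>"
  have nu: "norm u = 1" using eps by (simp add: u_def npc)
  have uniq: "v = u" if v: "v \<in> normal_cone L p" "norm v = 1" for v
  proof -
    have vd: "v \<in> direction_space L" and vn: "\<And>y. y \<in> L \<Longrightarrow> v \<bullet> (y - p) \<le> 0"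
      using v unfolding normal_cone_def by auto
    \<comment> \<open>Testing a unit normal \<open>v\<close> on \<open>c s + l *\<^sub>R v\<close>
      with \<open>l\<close> close to \<open>\<epsilon>\<close> leads to
      \<open>1 \<le> v \<bullet> u\<close>, which forces the unit vectors \<open>v\<close> and
      \<open>u\<close> to be equal.\<close>
    have le: "l \<le> v \<bullet> (p - c s)" if "l < \<epsilon>" "l > 0" for l
    proof -
      have "c s + l *\<^sub>R v \<in> L"
        using that v(2) sub vd by (intro in_ball subspace_scale) auto
      from vn[OF this] show ?thesis
        using v(2) by (simp add: inner_diff_right inner_add_right algebra_simps dot_square_norm)
    qed
    have "\<epsilon> \<le> v \<bullet> (p - c s)"
    proof (rule ccontr)
      assume "\<not> ?thesis"
      then obtain l where "max 0 (v \<bullet> (p - c s)) < l" "l < \<epsilon>"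
        using eps(1) dense[of "max 0 (v \<bullet> (p - c s))" \<epsilon>] by auto
      then show False using le[of l] by auto
    qed
    then have "1 \<le> v \<bullet> u" using eps(1) unfolding u_def inner_scaleR_right by (simp add: field_simps)
    moreover have "v \<bullet> v = 1" "u \<bullet> u = 1" using v(2) nu by (simp_all add: dot_square_norm)
    ultimately have "(norm (v - u))\<^sup>2 \<le> 0"
      unfolding power2_norm_eq_inner inner_diff_left inner_diff_right inner_commute[of u v] by linarith
    then show ?thesis by simp
  qed
  obtain v where v: "v \<in> normal_cone L p" "norm v = 1"
    using unit_normal_exists[OF assms(2) pL pni] .
  have un: "unit_normal_at L p u"
    unfolding unit_normal_at_def regular_point_def rel_frontier_def
    using v uniq pL pni closure_subset by blast
  have ud: "u \<in> direction_space L" and uL: "\<And>y. y \<in> L \<Longrightarrow> u \<bullet> (y - p) \<le> 0"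
    using un unfolding unit_normal_at_def normal_cone_def by auto
  have "a + r *\<^sub>R u \<in> L"
  proof -
    have "a + r *\<^sub>R u \<in> ?A" using aA ud sub by (intro add_direction_space subspace_scale)
    then show ?thesis using r nu by (auto simp: dist_norm)
  qed
  from uL[OF this] have ua: "u \<bullet> (a - p) \<le> - r"
    using nu by (simp add: inner_diff_right inner_add_right dot_square_norm)
  have cp: "u \<bullet> (c s - p) = - \<epsilon>"
    unfolding minus_diff_eq[of p "c s", symmetric] inner_minus_right u_def inner_scaleR_left
      dot_square_norm npc
    using eps(1) by (simp add: power2_eq_square)
  \<comment> \<open>The centre divides the segment from \<open>a\<close> to \<open>q\<close>.
    Measured from \<open>p\<close> along \<open>u\<close> it has depth only
    \<open>\<epsilon>\<close>, while \<open>a\<close> has depth at least \<open>r\<close>; the bound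
    \<open>2 * \<epsilon> \<le> (1 - s) * r\<close> then puts \<open>q\<close> strictly on the outer
    side.\<close>
  have cq: "c s - p = (1 - s) *\<^sub>R (a - p) + s *\<^sub>R (q - p)" by (simp add: c_def algebra_simps)
  have "c s \<in> L" using in_ball[of 0] eps(1) sub by (simp add: subspace_0)
  then have "\<delta> \<le> dist q (c s)" unfolding \<delta>_def by (rule infdist_le)
  moreover have "q - c s = (1 - s) *\<^sub>R (q - a)" by (simp add: c_def algebra_simps)
  ultimately have "\<delta> \<le> (1 - s) * D" using s by (simp add: dist_norm D_def)
  then have "r * \<delta> \<le> r * ((1 - s) * D)" using r(1) by simp
  then have e2: "2 * \<epsilon> \<le> (1 - s) * r" unfolding \<epsilon>_def using D \<delta> by (simp add: field_simps)
  have "(1 - s) * (u \<bullet> (a - p)) \<le> (1 - s) * (- r)" using ua s by (intro mult_left_mono) auto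
  then have "s * (u \<bullet> (q - p)) > 0"
    using cp e2 eps(1) unfolding cq inner_add_right inner_scaleR_right by simp
  then have "u \<bullet> (q - p) > 0" using s by (simp add: zero_less_mult_iff)
  then show ?thesis using that un by (simp add: inner_diff_right)
qed

section \<open>Small simplicial families imply reliability\<close>

lemma subspace_superset_of_dim:
  fixes S :: "'a::euclidean_space set"
  assumes "subspace S" "dim S \<le> d" "d \<le> DIM('a)"
  shows "\<exists>T. subspace T \<and> S \<subseteq> T \<and> dim T = d"
  using assms
proof (induction "d - dim S" arbitrary: S)
  case 0
  then show ?case by auto
next
  case (Suc k)
  then have "dim S < DIM('a)" by linarith
  then have "span S \<noteq> UNIV" by (metis dim_eq_full less_irrefl)
  then obtain x where x: "x \<notin> span S" by blast
  have d: "dim (span (insert x S)) = dim S + 1" using x by (simp add: dim_insert)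
  then have "\<exists>T. subspace T \<and> span (insert x S) \<subseteq> T \<and> dim T = d"
    using Suc(2,4,5) by (intro Suc(1)) auto
  then show ?case using span_superset by blast
qed

text \<open>A vector of \<open>\<xi>\<close> has the same inner product with a point and with its
  projection to \<open>\<xi>\<close>. Choosing a \<open>d\<close>-dimensional \<open>\<xi>\<close>
  around \<open>U\<close> removes the projections, with one \<open>t\<close> for all of
  \<open>K\<close>.\<close>

lemma contains_translate_proj_support:
  fixes L K :: "'a::euclidean_space set"
  assumes proj: "\<And>\<xi>. subspace \<xi> \<Longrightarrow> dim \<xi> = d \<Longrightarrow>
      contains_translate (proj_onto \<xi> L) (proj_onto \<xi> K)"
    and U: "dim U \<le> d" and d: "d \<le> DIM('a)"
  shows "\<exists>t. \<forall>x\<in>K. \<exists>y\<in>L. \<forall>u\<in>U. u \<bullet> (t + x) = u \<bullet> y"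
proof -
  obtain \<xi> where xi: "subspace \<xi>" "span U \<subseteq> \<xi>" "dim \<xi> = d"
    using subspace_superset_of_dim[OF subspace_span, of U d] U d by auto
  then obtain t where t: "(\<lambda>x. t + x) ` proj_onto \<xi> K \<subseteq> proj_onto \<xi> L"
    using proj unfolding contains_translate_def by blast
  have "\<exists>y\<in>L. \<forall>u\<in>U. u \<bullet> (t + x) = u \<bullet> y" if "x \<in> K" for x
  proof -
    obtain p q where pq: "p \<in> \<xi>" "\<And>w. w \<in> \<xi> \<Longrightarrow> w \<bullet> q = 0" "x = p + q"
      by (metis subspace_orthogonal_decomp[OF xi(1), of x])
    have "p \<in> proj_onto \<xi> K"
      unfolding proj_onto_def using that pq by (auto simp: orthogonal_def inner_commute intro!: bexI[of _ x])
    then have "t + p \<in> proj_onto \<xi> L" using t by blast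
    then obtain y where y: "y \<in> L" "\<forall>w\<in>\<xi>. orthogonal (y - (t + p)) w"
      unfolding proj_onto_def by blast
    have "u \<bullet> (t + x) = u \<bullet> y" if "u \<in> U" for u
    proof -
      have "u \<in> \<xi>" using that xi(2) span_superset by blast
      then have "(y - (t + p)) \<bullet> u = 0" "u \<bullet> q = 0" using y(2) pq(2) unfolding orthogonal_def by auto
      then show ?thesis
        unfolding pq(3) inner_add_right inner_diff_left inner_add_left
        by (simp add: inner_commute)
    qed
    then show ?thesis using y(1) by blast
  qed
  then show ?thesis by blast
qed

lemma reliable_if_simplicial_families_small:
  fixes L :: "'a::euclidean_space set"
  assumes L: "compact L" "convex L" "L \<noteq> {}" and d: "1 \<le> d" "d \<le> DIM('a)"
    and fam: "\<And>U. simplicial_family U \<Longrightarrow> (\<forall>u\<in>U. \<exists>x. unit_normal_at L x u) \<Longrightarrow> card U \<le> d + 1"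
  shows "reliable d L"
  unfolding reliable_def
proof (intro allI impI)
  fix K :: "'a set"
  assume "compact K \<and> convex K \<and> K \<noteq> {} \<and>
    (\<forall>\<xi>. subspace \<xi> \<and> dim \<xi> = d \<longrightarrow> contains_translate (proj_onto \<xi> L) (proj_onto \<xi> K))"
  then have K: "compact K" "K \<noteq> {}" and proj: "\<And>\<xi>. subspace \<xi> \<Longrightarrow> dim \<xi> = d \<Longrightarrow>
      contains_translate (proj_onto \<xi> L) (proj_onto \<xi> K)" by auto
  let ?V = "direction_space L"
  have V: "subspace ?V" using L(3) by (rule direction_space_parallel)
  obtain l0 k0 where l0: "l0 \<in> L" and k0: "k0 \<in> K" using L(3) K(2) by blast
  have l0A: "l0 \<in> affine hull L" using l0 by (rule hull_inc)
  \<comment> \<open>\<open>K\<close> is parallel to the affine hull of \<open>L\<close>: the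
    component \<open>w\<close> of \<open>k - k0\<close> orthogonal to \<open>?V\<close> fits into
    some \<open>\<xi>\<close> because \<open>1 \<le> d\<close>, and \<open>L\<close> has width 0
    along \<open>w\<close>.\<close>
  have flat: "k - k0 \<in> ?V" if k: "k \<in> K" for k
  proof -
    obtain v w where vw: "v \<in> ?V" "\<And>y. y \<in> ?V \<Longrightarrow> y \<bullet> w = 0" "k - k0 = v + w"
      by (metis subspace_orthogonal_decomp[OF V, of "k - k0"])
    have "dim {w} \<le> d" using d(1) by (simp add: dim_insert)
    from contains_translate_proj_support[OF proj this d(2)]
    obtain t where t: "\<And>x. x \<in> K \<Longrightarrow> \<exists>y\<in>L. w \<bullet> (t + x) = w \<bullet> y" by auto
    obtain y1 y2 where y: "y1 \<in> L" "w \<bullet> (t + k) = w \<bullet> y1" "y2 \<in> L" "w \<bullet> (t + k0) = w \<bullet> y2"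
      using t[OF k] t[OF k0] by blast
    have "y1 - y2 \<in> ?V" using y(1,3) by (intro diff_in_direction_space hull_inc)
    then have "(y1 - y2) \<bullet> w = 0" by (rule vw(2))
    then have "w \<bullet> (k - k0) = 0"
      using y(2,4) by (simp add: inner_diff_right inner_add_right inner_diff_left inner_commute)
    then have "w \<bullet> w = 0" using vw(2)[OF vw(1)] vw(3) by (simp add: inner_add_right inner_commute)
    then show ?thesis using vw by simp
  qed
  define N where "N = {u. \<exists>x. unit_normal_at L x u}"
  have NV: "N \<subseteq> ?V" and N1: "\<And>u. u \<in> N \<Longrightarrow> norm u = 1"
    unfolding N_def unit_normal_at_def normal_cone_def by auto
  \<comment> \<open>Maximizers \<open>p u\<close> and \<open>q u\<close> are chosen so that
    \<open>u \<bullet> p u\<close> and \<open>u \<bullet> q u\<close> are the support functions of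
    \<open>L\<close> and \<open>K\<close>.\<close>
  have "\<exists>x\<in>L. \<forall>y\<in>L. u \<bullet> y \<le> u \<bullet> x" for u
    by (rule continuous_attains_sup[OF L(1,3)]) (intro continuous_intros)
  then obtain p where p: "\<And>u. p u \<in> L" "\<And>u y. y \<in> L \<Longrightarrow> u \<bullet> y \<le> u \<bullet> p u" by metis
  have "\<exists>x\<in>K. \<forall>y\<in>K. u \<bullet> y \<le> u \<bullet> x" for u
    by (rule continuous_attains_sup[OF K]) (intro continuous_intros)
  then obtain q where q: "\<And>u. q u \<in> K" "\<And>u y. y \<in> K \<Longrightarrow> u \<bullet> y \<le> u \<bullet> q u" by metis
  have mem: "y \<in> L" if y: "y \<in> affine hull L" "\<And>u. u \<in> N \<Longrightarrow> u \<bullet> y \<le> u \<bullet> p u" for y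
  proof (rule ccontr)
    assume "y \<notin> L"
    then obtain x u where xu: "unit_normal_at L x u" "u \<bullet> x < u \<bullet> y"
      by (metis regular_normal_separates[OF compact_imp_closed[OF L(1)] L(2,3) y(1)])
    have "u \<bullet> (p u - x) \<le> 0"
      using xu(1) p(1) unfolding unit_normal_at_def normal_cone_def by blast
    moreover have "u \<in> N" using xu(1) unfolding N_def by blast
    ultimately show False using y(2)[of u] xu(2) by (simp add: inner_diff_right)
  qed
  \<comment> \<open>Shifting by \<open>s\<close> moves \<open>k0\<close> to \<open>l0\<close>, hence
    \<open>K\<close> into the affine hull of \<open>L\<close>, so the rest of the translation can be
    sought in \<open>?V\<close>.\<close>
  define s where "s = l0 - k0"
  define g where "g u = u \<bullet> p u - u \<bullet> (s + q u)" for u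
  have "\<exists>t\<in>?V. \<forall>u\<in>N. u \<bullet> t \<le> g u"
  proof (rule feasible_on_subspace[OF V NV])
    \<comment> \<open>A nonzero recession direction would put a whole ray from \<open>l0\<close>
      into the bounded set \<open>L\<close>.\<close>
    fix t assume t: "t \<in> ?V" "\<And>u. u \<in> N \<Longrightarrow> u \<bullet> t \<le> 0"
    have ray: "l0 + r *\<^sub>R t \<in> L" if "r \<ge> 0" for r
    proof (rule mem)
      show "l0 + r *\<^sub>R t \<in> affine hull L"
        using l0A t(1) V by (intro add_direction_space subspace_scale)
      fix u assume "u \<in> N"
      then have "r * (u \<bullet> t) \<le> 0" using t(2) that by (simp add: mult_nonneg_nonpos)
      then show "u \<bullet> (l0 + r *\<^sub>R t) \<le> u \<bullet> p u" using p(2)[OF l0, of u] by (simp add: inner_add_right)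
    qed
    obtain B where B: "\<And>x. x \<in> L \<Longrightarrow> norm x \<le> B"
      using compact_imp_bounded[OF L(1)] unfolding bounded_iff by blast
    show "t = 0"
    proof (rule ccontr)
      assume "t \<noteq> 0"
      have "B \<ge> 0" using B[OF l0] norm_ge_zero order_trans by blast
      define r where "r = (2 * B + 1) / norm t"
      have "r \<ge> 0" unfolding r_def using \<open>B \<ge> 0\<close> by simp
      have "norm (r *\<^sub>R t) = 2 * B + 1" unfolding r_def using \<open>t \<noteq> 0\<close> \<open>B \<ge> 0\<close> by simp
      moreover have "norm (r *\<^sub>R t) \<le> norm (l0 + r *\<^sub>R t) + norm l0"
        using norm_triangle_ineq4[of "l0 + r *\<^sub>R t" l0] by simp
      ultimately show False using B[OF ray[OF \<open>r \<ge> 0\<close>]] B[OF l0] by linarith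
    qed
  next
    fix F assume F: "finite F" "F \<subseteq> N"
    show "\<exists>t. \<forall>u\<in>F. u \<bullet> t \<le> g u"
    proof (rule ccontr)
      assume "\<nexists>t. \<forall>u\<in>F. u \<bullet> t \<le> g u"
      from farkas_circuit[OF F(1) this]
      obtain U c where U: "U \<subseteq> F" and c: "\<forall>u\<in>U. c u > 0" "(\<Sum>u\<in>U. c u *\<^sub>R u) = 0"
        "(\<Sum>u\<in>U. c u * g u) < 0" and dU: "dim (span U) + 1 = card U"
        by blast
      have UN: "U \<subseteq> N" using U F(2) by blast
      have finU: "finite U" using U F(1) finite_subset by blast
      have "dim (span U) \<noteq> 0"
      proof
        assume "dim (span U) = 0"
        then have "U \<subseteq> {0}" by simp
        moreover have "U \<noteq> {}" using dU by auto
        ultimately have "0 \<in> N" using UN by blast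
        then show False using N1 by fastforce
      qed
      moreover have "k_simplicial_family (dim (span U)) U"
        unfolding k_simplicial_family_def using finU dU c UN N1 by auto
      ultimately have "simplicial_family U"
        unfolding simplicial_family_def by (metis less_one not_le)
      then have "card U \<le> d + 1" using UN unfolding N_def by (intro fam) auto
      \<comment> \<open>One \<open>d\<close>-dimensional subspace contains the whole family, so a
        single \<open>t\<close> serves all its inequalities; \<open>t - s\<close> then solves the
        subsystem that \<open>c\<close> certifies as infeasible.\<close>
      then have "dim U \<le> d" using dU by simp
      from contains_translate_proj_support[OF proj this d(2)]
      obtain t where t: "\<And>x. x \<in> K \<Longrightarrow> \<exists>y\<in>L. \<forall>u\<in>U. u \<bullet> (t + x) = u \<bullet> y" by blast
      have ge: "u \<bullet> (t - s) \<le> g u" if u: "u \<in> U" for u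
      proof -
        obtain y where y: "y \<in> L" "u \<bullet> (t + q u) = u \<bullet> y" using t[OF q(1), of u] u by blast
        show ?thesis using p(2)[OF y(1), of u] y(2)
          by (simp add: g_def inner_diff_right inner_add_right)
      qed
      have "0 = (\<Sum>u\<in>U. c u *\<^sub>R u) \<bullet> (t - s)" using c(2) by simp
      also have "\<dots> = (\<Sum>u\<in>U. c u * (u \<bullet> (t - s)))" by (simp add: inner_sum_left)
      also have "\<dots> \<le> (\<Sum>u\<in>U. c u * g u)"
        using ge c(1) by (intro sum_mono mult_left_mono) (auto simp: less_imp_le)
      finally show False using c(3) by simp
    qed
  qed
  then obtain t where t: "t \<in> ?V" "\<And>u. u \<in> N \<Longrightarrow> u \<bullet> t \<le> g u" by blast
  have "(t + s) + k \<in> L" if k: "k \<in> K" for k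
  proof (rule mem)
    have eq: "(t + s) + k = l0 + (t + (k - k0))" by (simp add: s_def)
    show "(t + s) + k \<in> affine hull L"
      unfolding eq by (rule add_direction_space[OF l0A subspace_add[OF V t(1) flat[OF k]]])
    fix u assume "u \<in> N"
    then show "u \<bullet> (t + s + k) \<le> u \<bullet> p u"
      using t(2)[of u] q(2)[OF k, of u] by (simp add: g_def inner_add_right)
  qed
  then show "contains_translate L K" unfolding contains_translate_def by blast
qed

section \<open>Large simplicial families prevent reliability\<close>

text \<open>The dimensions of \<open>S\<close> and of the orthogonal complement of
  \<open>\<xi>\<close> add up to more than that of the space, so the two share a nonzero
  vector.\<close>

lemma not_orthogonal_to_all:
  fixes S \<xi> :: "'a::euclidean_space set"
  assumes "subspace S" "subspace \<xi>" "dim \<xi> < dim S"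
  obtains e where "e \<in> S" "norm e = 1" "\<And>w. w \<in> \<xi> \<Longrightarrow> e \<bullet> w = 0"
proof -
  define P where "P = {y. \<forall>x\<in>\<xi>. orthogonal x y}"
  have P: "subspace P" unfolding P_def by (rule subspace_orthogonal_to_vectors)
  have "dim P + dim \<xi> = DIM('a)"
    using dim_subspace_orthogonal_to_vectors[OF assms(2) subspace_UNIV] unfolding P_def by simp
  moreover have "dim {x + y | x y. x \<in> S \<and> y \<in> P} + dim (S \<inter> P) = dim S + dim P"
    using assms(1) P by (rule dim_sums_Int)
  moreover have "dim {x + y | x y. x \<in> S \<and> y \<in> P} \<le> DIM('a)" by (rule dim_subset_UNIV)
  ultimately have "dim (S \<inter> P) \<noteq> 0" using assms(3) by linarith
  then have "\<not> S \<inter> P \<subseteq> {0}" by simp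
  then obtain v where v: "v \<in> S" "v \<in> P" "v \<noteq> 0" by blast
  show ?thesis
  proof
    show "v /\<^sub>R norm v \<in> S" using v assms(1) by (simp add: subspace_scale)
    show "norm (v /\<^sub>R norm v) = 1" using v by simp
    show "(v /\<^sub>R norm v) \<bullet> w = 0" if "w \<in> \<xi>" for w
      using v(2) that unfolding P_def orthogonal_def by (auto simp: inner_commute)
  qed
qed

text \<open>Separating \<open>L \<times> \<dots> \<times> L\<close> from the affine space of all translates modulo \<open>\<xi>\<^sup>\<bottom>\<close> of the tuple \<open>z\<close>
  turns the failure of the containment into one dual vector \<open>v $ i\<close> for each vertex.\<close>

lemma contains_translate_proj_or_separated:
  fixes L \<xi> :: "'a::euclidean_space set" and z :: "'a ^ 'i::finite"
  assumes L: "compact L" "convex L" "L \<noteq> {}" and xi: "subspace \<xi>"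
    and no: "\<not> contains_translate (proj_onto \<xi> L) (proj_onto \<xi> (convex hull (range (($) z))))"
  obtains v :: "'a ^ 'i" where "\<And>i. v $ i \<in> \<xi>" "(\<Sum>i\<in>UNIV. v $ i) = 0"
    "\<And>a. (\<And>i. a $ i \<in> L) \<Longrightarrow> v \<bullet> (a - z) < 0"
proof -
  let ?P = "{y. \<forall>w\<in>\<xi>. y \<bullet> w = 0}"
  have P: "subspace ?P" by (auto simp: subspace_def inner_add_left)
  define A where "A = {a :: 'a ^ 'i. \<forall>i. a $ i \<in> L}"
  \<comment> \<open>The tuples that are constant modulo the orthogonal complement of
    \<open>\<xi>\<close>; adding one to \<open>z\<close> translates the projected tuple.\<close>
  define M where "M = {m :: 'a ^ 'i. \<exists>t. \<forall>i. m $ i - t \<in> ?P}"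
  have M: "subspace M"
    unfolding subspace_def
  proof (intro conjI ballI allI)
    show "0 \<in> M" unfolding M_def by (auto intro!: exI[of _ 0])
    fix x assume "x \<in> M"
    then obtain s where s: "\<forall>i. x $ i - s \<in> ?P" unfolding M_def by blast
    show "r *\<^sub>R x \<in> M" for r
    proof -
      have "(r *\<^sub>R x) $ i - r *\<^sub>R s \<in> ?P" for i
        using subspace_scale[OF P, of "x $ i - s" r] s by (simp add: algebra_simps)
      then show ?thesis unfolding M_def by blast
    qed
    fix y assume "y \<in> M"
    then obtain t where t: "\<forall>i. y $ i - t \<in> ?P" unfolding M_def by blast
    have "(x + y) $ i - (s + t) \<in> ?P" for i
      using subspace_add[OF P, of "x $ i - s" "y $ i - t"] s t by (simp add: algebra_simps)
    then show "x + y \<in> M" unfolding M_def by blast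
  qed
  have cA: "convex A"
    using L(2) unfolding A_def convex_def by auto
  have "compact A"
  proof -
    have "closed A"
    proof -
      have "A = (\<Inter>i. (\<lambda>a. a $ i) -` L)" unfolding A_def by auto
      moreover have "closed ((\<lambda>a::'a^'i. a $ i) -` L)" for i
        by (rule closed_vimage[OF compact_imp_closed[OF L(1)]]) (intro continuous_intros)
      ultimately show ?thesis by auto
    qed
    moreover have "bounded A"
    proof -
      obtain B where B: "\<And>x. x \<in> L \<Longrightarrow> norm x \<le> B"
        using compact_imp_bounded[OF L(1)] unfolding bounded_iff by blast
      have "norm a \<le> (\<Sum>i\<in>(UNIV::'i set). B)" if "a \<in> A" for a
      proof -
        have "norm a \<le> (\<Sum>i\<in>UNIV. norm (a $ i))"
          unfolding norm_vec_def by (rule L2_set_le_sum) simp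
        also have "\<dots> \<le> (\<Sum>i\<in>(UNIV::'i set). B)" using that unfolding A_def by (intro sum_mono B) auto
        finally show ?thesis .
      qed
      then show ?thesis by (auto simp: bounded_iff)
    qed
    ultimately show ?thesis using compact_eq_bounded_closed by blast
  qed
  moreover obtain l0 where "l0 \<in> L" using L(3) by blast
  then have "A \<noteq> {}" unfolding A_def by (auto intro!: exI[of _ "\<chi> i. l0"])
  moreover have "A \<inter> (+) z ` M = {}"
  proof (rule ccontr)
    assume "A \<inter> (+) z ` M \<noteq> {}"
    then obtain m where m: "z + m \<in> A" "m \<in> M" by auto
    then obtain t where t: "\<And>i. m $ i - t \<in> ?P" unfolding M_def by blast
    \<comment> \<open>The points that translation by \<open>t\<close> carries into \<open>L\<close>
      modulo the orthogonal complement of \<open>\<xi>\<close>. This set is convex, so it suffices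
      to check the vertices of the hull.\<close>
    define C where "C = {x. \<exists>a\<in>L. a - t - x \<in> ?P}"
    have "convex hull (range (($) z)) \<subseteq> C"
    proof (rule hull_minimal)
      show "range (($) z) \<subseteq> C"
      proof
        fix x assume "x \<in> range (($) z)"
        then obtain i where i: "x = z $ i" by blast
        have "(z + m) $ i \<in> L" using m(1) unfolding A_def by blast
        moreover have "(z + m) $ i - t - x = m $ i - t" by (simp add: i)
        ultimately show "x \<in> C" unfolding C_def using t[of i] by (metis (no_types, lifting) mem_Collect_eq)
      qed
      show "convex C"
      proof (rule convexI)
        fix x y and u v :: real assume xy: "x \<in> C" "y \<in> C" and uv: "0 \<le> u" "0 \<le> v" "u + v = 1"
        obtain a b where a: "a \<in> L" "a - t - x \<in> ?P" and b: "b \<in> L" "b - t - y \<in> ?P"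
          using xy unfolding C_def by blast
        have "u *\<^sub>R a + v *\<^sub>R b \<in> L" using L(2) a(1) b(1) uv by (rule convexD)
        moreover have "u *\<^sub>R (a - t - x) + v *\<^sub>R (b - t - y) \<in> ?P"
          using a(2) b(2) by (intro subspace_add[OF P] subspace_scale[OF P])
        moreover have "u *\<^sub>R (a - t - x) + v *\<^sub>R (b - t - y)
            = u *\<^sub>R a + v *\<^sub>R b - (u + v) *\<^sub>R t - (u *\<^sub>R x + v *\<^sub>R y)"
          by (simp add: algebra_simps)
        ultimately show "u *\<^sub>R x + v *\<^sub>R y \<in> C"
          unfolding C_def uv(3) scaleR_one mem_Collect_eq by metis
      qed
    qed
    obtain t1 t2 where t12: "t1 \<in> \<xi>" "\<And>w. w \<in> \<xi> \<Longrightarrow> w \<bullet> t2 = 0" "t = t1 + t2"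
      by (metis subspace_orthogonal_decomp[OF xi, of t])
    have "t1 + y \<in> proj_onto \<xi> L" if yP: "y \<in> proj_onto \<xi> (convex hull (range (($) z)))" for y
    proof -
      obtain x where y: "y \<in> \<xi>" and x: "x \<in> C" "\<And>w. w \<in> \<xi> \<Longrightarrow> (x - y) \<bullet> w = 0"
        using yP \<open>convex hull (range (($) z)) \<subseteq> C\<close> unfolding proj_onto_def orthogonal_def by blast
      obtain a where a: "a \<in> L" "\<And>w. w \<in> \<xi> \<Longrightarrow> (a - t - x) \<bullet> w = 0"
        using x(1) unfolding C_def by blast
      have "(a - (t1 + y)) \<bullet> w = 0" if "w \<in> \<xi>" for w
      proof -
        have "a - (t1 + y) = (a - t - x) + t2 + (x - y)" by (simp add: t12(3))
        then show ?thesis using a(2)[OF that] x(2)[OF that] t12(2)[OF that]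
          by (simp only: inner_add_left inner_commute[of t2 w])
      qed
      then show ?thesis unfolding proj_onto_def orthogonal_def
        using a(1) y t12(1) subspace_add[OF xi] by blast
    qed
    then show False using no unfolding contains_translate_def by blast
  qed
  moreover have "convex ((+) z ` M)" "closed ((+) z ` M)"
    using M by (auto intro: convex_translation subspace_imp_convex closed_translation closed_subspace)
  ultimately obtain v b where v: "\<And>x. x \<in> A \<Longrightarrow> v \<bullet> x < b" "\<And>x. x \<in> (+) z ` M \<Longrightarrow> v \<bullet> x > b"
    using separating_hyperplane_compact_closed[OF cA] by metis
  \<comment> \<open>A functional bounded below on a translate of a subspace vanishes on the
    subspace. Tuples with a single nonzero entry orthogonal to \<open>\<xi>\<close> then give
    \<open>v $ i \<in> \<xi>\<close>, and constant tuples give the zero sum.\<close>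
  have vM: "v \<bullet> m = 0" if m: "m \<in> M" for m
  proof (rule ccontr)
    assume ne: "v \<bullet> m \<noteq> 0"
    define r where "r = (b - v \<bullet> z) / (v \<bullet> m)"
    have "z + r *\<^sub>R m \<in> (+) z ` M" using subspace_scale[OF M m] by blast
    from v(2)[OF this] show False using ne by (simp add: inner_add_right r_def)
  qed
  have vz: "v \<bullet> z > b" using v(2)[of z] subspace_0[OF M] by force
  have axis_inner: "v \<bullet> (\<chi> j. if j = i then y else 0) = v $ i \<bullet> y" for i y
    by (simp add: inner_vec_def if_distrib [of "\<lambda>r. _ \<bullet> r"] cong: if_cong)
  show ?thesis
  proof
    show "v $ i \<in> \<xi>" for i
    proof -
      obtain y w where yw: "y \<in> \<xi>" "\<And>x. x \<in> \<xi> \<Longrightarrow> x \<bullet> w = 0" "v $ i = y + w"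
        by (metis subspace_orthogonal_decomp[OF xi, of "v $ i"])
      have "(\<chi> j. if j = i then w else 0) \<in> M"
        unfolding M_def using yw(2) by (auto intro!: exI[of _ 0] simp: inner_commute)
      from vM[OF this] have "v $ i \<bullet> w = 0" by (simp only: axis_inner)
      then have "w \<bullet> w = 0" using yw(2)[OF yw(1)] unfolding yw(3) inner_add_left by simp
      then show ?thesis using yw by simp
    qed
    have eq: "(\<Sum>i\<in>UNIV. v $ i) \<bullet> t = 0" for t
    proof -
      have "(\<chi> i. t) \<in> M" unfolding M_def by (auto intro!: exI[of _ t])
      from vM[OF this] show ?thesis by (simp add: inner_vec_def inner_sum_left)
    qed
    show "(\<Sum>i\<in>UNIV. v $ i) = 0" using eq[of "\<Sum>i\<in>UNIV. v $ i"] by simp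
    show "v \<bullet> (a - z) < 0" if "\<And>i. a $ i \<in> L" for a
      using v(1)[of a] vz that unfolding A_def by (auto simp: inner_diff_right)
  qed
qed

text \<open>Any \<open>k\<close> members of the family are independent, because the positive
  relation puts the omitted one into their span. So a relation that vanishes at one member vanishes
  altogether.\<close>

lemma simplicial_relation_positive:
  fixes U :: "'a::euclidean_space set"
  assumes U: "k_simplicial_family k U" and b: "\<And>u. u \<in> U \<Longrightarrow> b u \<ge> 0"
    and sum0: "(\<Sum>u\<in>U. b u *\<^sub>R u) = 0" and ne: "w \<in> U" "b w \<noteq> 0" and u: "u \<in> U"
  shows "b u > 0"
proof (rule ccontr)
  assume "\<not> b u > 0"
  then have bu: "b u = 0" using b[OF u] by simp
  obtain c where c: "\<And>u. u \<in> U \<Longrightarrow> c u > 0" "(\<Sum>u\<in>U. c u *\<^sub>R u) = 0"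
    and fin: "finite U" and card: "card U = k + 1" and dim: "dim (span U) = k"
    using U unfolding k_simplicial_family_def by blast
  let ?U = "U - {u}"
  have "c u *\<^sub>R u = - (\<Sum>v\<in>?U. c v *\<^sub>R v)"
    using c(2) sum.remove[OF fin u, of "\<lambda>v. c v *\<^sub>R v"] by (simp add: eq_neg_iff_add_eq_0)
  also have "\<dots> \<in> span ?U" by (intro span_neg span_sum span_mul span_base)
  finally have "(1 / c u) *\<^sub>R (c u *\<^sub>R u) \<in> span ?U" by (rule span_mul)
  then have "u \<in> span ?U" using c(1)[OF u] by simp
  then have "span (insert u ?U) = span ?U" by (rule span_redundant)
  then have "dim (span ?U) = k" using dim u by (simp add: insert_absorb)
  moreover have "card ?U = k" using card card.remove[OF fin u] by simp
  ultimately have "independent ?U"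
    using fin by (intro card_le_dim_spanning[of _ "span ?U"]) (auto simp: span_superset)
  moreover have "(\<Sum>v\<in>?U. b v *\<^sub>R v) = 0"
    using sum0 sum.remove[OF fin u, of "\<lambda>v. b v *\<^sub>R v"] bu by simp
  moreover have "w \<in> ?U" using ne bu by auto
  ultimately show False using fin ne(2) by (metis dependent_finite finite_Diff)
qed

text \<open>The normal cone is closed under positive scaling and has a single unit vector, so it is
  one ray.\<close>

lemma normal_cone_regular_point:
  assumes u: "unit_normal_at L x u" and w: "w \<in> normal_cone L x"
  shows "w = norm w *\<^sub>R u"
proof (cases "w = 0")
  case False
  have "x \<in> rel_frontier L" using u unfolding unit_normal_at_def regular_point_def by blast
  then have "L \<noteq> {}" by auto
  then have V: "subspace (direction_space L)" by (rule direction_space_parallel)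
  have "w /\<^sub>R norm w \<in> normal_cone L x"
    using w subspace_scale[OF V] unfolding normal_cone_def
    by (auto simp: mult_nonneg_nonpos)
  moreover have "norm (w /\<^sub>R norm w) = 1" using False by simp
  ultimately have "w /\<^sub>R norm w = u"
    using u unfolding unit_normal_at_def regular_point_def by blast
  then show ?thesis using False by auto
qed simp

text \<open>A relative ball around \<open>p\<close> reaches \<open>p + r *\<^sub>R u\<close> inside
  \<open>L\<close>, so \<open>p\<close> lies at depth at least \<open>r\<close> below the supporting
  hyperplane.\<close>

lemma unit_normal_at_strict:
  fixes L :: "'a::euclidean_space set"
  assumes u: "unit_normal_at L x u" and p: "p \<in> rel_interior L"
  shows "u \<bullet> (x - p) > 0"
proof -
  obtain r where r: "r > 0" "cball p r \<inter> affine hull L \<subseteq> L" using p mem_rel_interior_cball by blast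
  have uV: "u \<in> direction_space L" and un: "norm u = 1" and le: "\<And>y. y \<in> L \<Longrightarrow> u \<bullet> (y - x) \<le> 0"
    using u unfolding unit_normal_at_def normal_cone_def by auto
  have pL: "p \<in> L" using p rel_interior_subset by blast
  then have "subspace (direction_space L)" by (intro direction_space_parallel) auto
  then have "p + r *\<^sub>R u \<in> affine hull L"
    using uV pL by (intro add_direction_space subspace_scale hull_inc)
  then have "p + r *\<^sub>R u \<in> L" using r un by (auto simp: dist_norm)
  from le[OF this] show ?thesis
    using r(1) un by (simp add: inner_diff_right inner_add_right dot_square_norm)
qed

text \<open>The index type \<open>'i\<close> turns tuples of points of \<open>L\<close> into vectors
  of the Euclidean space \<open>'a ^ 'i\<close>; \<open>f\<close> may repeat members of
  \<open>U\<close>.\<close>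

lemma not_reliable_if_simplicial_family_large:
  fixes L :: "'a::euclidean_space set" and f :: "'i::finite \<Rightarrow> 'a"
  assumes L: "compact L" "convex L" "L \<noteq> {}" and U: "k_simplicial_family k U" and d: "d < k"
    and normals: "\<And>u. u \<in> U \<Longrightarrow> \<exists>x. unit_normal_at L x u" and f: "range f = U"
  shows "\<not> reliable d L"
proof
  assume rel: "reliable d L"
  let ?V = "direction_space L"
  have V: "subspace ?V" using L(3) by (rule direction_space_parallel)
  obtain c where c: "\<And>u. u \<in> U \<Longrightarrow> c u > 0" "(\<Sum>u\<in>U. c u *\<^sub>R u) = 0"
    and fin: "finite U" and dim: "dim (span U) = k"
    using U unfolding k_simplicial_family_def by blast
  obtain h where h: "\<And>u. u \<in> U \<Longrightarrow> unit_normal_at L (h u) u" using normals by metis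
  define x :: "'a ^ 'i" where "x = (\<chi> i. h (f i))"
  have xn: "unit_normal_at L (x $ i) (f i)" for i unfolding x_def using h f by auto
  have xL: "x $ i \<in> L" for i
    using xn[of i] compact_imp_closed[OF L(1)]
    unfolding unit_normal_at_def regular_point_def rel_frontier_def by simp
  obtain p where p: "p \<in> rel_interior L" using L rel_interior_eq_empty by blast
  have pL: "p \<in> L" using p rel_interior_subset by blast
  define z where "z \<epsilon> = x + \<epsilon> *\<^sub>R (x - (\<chi> i. p))" for \<epsilon> :: real
  have zV: "a - z \<epsilon> $ i \<in> ?V" if "a \<in> L" for a \<epsilon> i
  proof -
    have "a - x $ i \<in> ?V" "x $ i - p \<in> ?V" using that xL pL by (auto intro!: diff_in_direction_space hull_inc)
    then have "(a - x $ i) - \<epsilon> *\<^sub>R (x $ i - p) \<in> ?V" by (meson V subspace_diff subspace_scale)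
    then show ?thesis by (simp add: z_def algebra_simps)
  qed
  \<comment> \<open>A translation into \<open>L\<close> would have to move strictly against every
    normal in \<open>U\<close>, which the positive relation among them forbids.\<close>
  have notin: "\<not> contains_translate L (convex hull (range (($) (z \<epsilon>))))" if "\<epsilon> > 0" for \<epsilon>
  proof
    assume "contains_translate L (convex hull (range (($) (z \<epsilon>))))"
    then obtain t where "\<And>y. y \<in> convex hull (range (($) (z \<epsilon>))) \<Longrightarrow> t + y \<in> L"
      unfolding contains_translate_def by blast
    then have t: "t + z \<epsilon> $ i \<in> L" for i by (simp add: hull_inc)
    have neg: "u \<bullet> t < 0" if u: "u \<in> U" for u
    proof -
      obtain i where i: "u = f i" using u f by blast
      have "f i \<bullet> (t + z \<epsilon> $ i - x $ i) \<le> 0"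
        using xn[of i] t[of i] unfolding unit_normal_at_def normal_cone_def by blast
      moreover have "t + z \<epsilon> $ i - x $ i = t + \<epsilon> *\<^sub>R (x $ i - p)" by (simp add: z_def)
      ultimately have "f i \<bullet> t + \<epsilon> * (f i \<bullet> (x $ i - p)) \<le> 0" by (simp add: inner_add_right)
      moreover have "\<epsilon> * (f i \<bullet> (x $ i - p)) > 0"
        using \<open>\<epsilon> > 0\<close> unit_normal_at_strict[OF xn p] by simp
      ultimately show ?thesis unfolding i by linarith
    qed
    have "0 = (\<Sum>u\<in>U. c u *\<^sub>R u) \<bullet> t" using c(2) by simp
    also have "\<dots> = (\<Sum>u\<in>U. c u * (u \<bullet> t))" by (simp add: inner_sum_left)
    also have "\<dots> < (\<Sum>u\<in>U. 0)"
      using neg c(1) fin f by (intro sum_strict_mono) (auto simp: mult_pos_neg)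
    finally show False by simp
  qed
  \<comment> \<open>The subspaces \<open>\<xi>\<close> vary with \<open>\<epsilon>\<close>. Each is
    replaced by a unit vector of \<open>span U\<close> orthogonal to all components of the dual
    tuple, so that limits can be taken in a compact set.\<close>
  define D where "D = {q :: ('a ^ 'i) \<times> 'a. norm (fst q) = 1 \<and> norm (snd q) = 1 \<and> snd q \<in> span U \<and>
    (\<forall>i. fst q $ i \<in> ?V) \<and> (\<Sum>i\<in>UNIV. fst q $ i) = 0 \<and> (\<forall>i. snd q \<bullet> fst q $ i = 0)}"
  have "compact D"
  proof -
    have "D \<subseteq> cball 0 1 \<times> cball 0 1" unfolding D_def by auto
    then have "bounded D" by (rule bounded_subset[OF bounded_Times[OF bounded_cball bounded_cball]])
    moreover have "closed D"
    proof -
      have "D = {q. norm (fst q) = 1} \<inter> {q. norm (snd q) = 1} \<inter> snd -` span U \<inter>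
        (\<Inter>i. (\<lambda>q. fst q $ i) -` ?V) \<inter> {q. (\<Sum>i\<in>UNIV. fst q $ i) = 0} \<inter>
        (\<Inter>i. {q. snd q \<bullet> fst q $ i = 0})"
        unfolding D_def by auto
      moreover have "closed ?V" "closed (span U)" using V by (auto intro: closed_subspace)
      ultimately show ?thesis
        by (auto intro!: closed_Int closed_INT closed_Collect_eq closed_vimage continuous_intros)
    qed
    ultimately show ?thesis using compact_eq_bounded_closed by blast
  qed
  have ex: "\<exists>q\<in>D. \<forall>a. (\<forall>i. a $ i \<in> L) \<longrightarrow> fst q \<bullet> (a - z \<epsilon>) < 0" if eps: "\<epsilon> > 0" for \<epsilon>
  proof -
    let ?K = "convex hull (range (($) (z \<epsilon>)))"
    have "compact ?K" "convex ?K" "?K \<noteq> {}"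
      by (auto simp: finite_imp_compact_convex_hull)
    then obtain \<xi> where xi: "subspace \<xi>" "dim \<xi> = d"
      and no: "\<not> contains_translate (proj_onto \<xi> L) (proj_onto \<xi> ?K)"
      using rel notin[OF eps] unfolding reliable_def by blast
    obtain v where v: "\<And>i. v $ i \<in> \<xi>" "(\<Sum>i\<in>UNIV. v $ i) = 0"
        "\<And>a. (\<And>i. a $ i \<in> L) \<Longrightarrow> v \<bullet> (a - z \<epsilon>) < 0"
      by (metis contains_translate_proj_or_separated[OF L xi(1) no])
    have "dim \<xi> < dim (span U)" using xi(2) d dim by simp
    then obtain e where e: "e \<in> span U" "norm e = 1" "\<And>w. w \<in> \<xi> \<Longrightarrow> e \<bullet> w = 0"
      by (metis not_orthogonal_to_all[OF subspace_span xi(1)])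
    \<comment> \<open>The components are projected to \<open>?V\<close>, where the normal cones
      live. Inner products with \<open>e\<close> and with the components of
      \<open>a - z \<epsilon>\<close> do not change, since these lie in \<open>?V\<close>.\<close>
    have "\<exists>y. y \<in> ?V \<and> (\<forall>w\<in>?V. w \<bullet> (v $ i - y) = 0)" for i
      by (metis subspace_orthogonal_decomp[OF V, of "v $ i"] add_diff_cancel_left')
    then obtain y where y: "\<And>i. y i \<in> ?V" "\<And>i w. w \<in> ?V \<Longrightarrow> w \<bullet> (v $ i - y i) = 0" by metis
    define w where "w = (\<chi> i. y i)"
    have inner_w: "u \<bullet> w $ i = u \<bullet> v $ i" if "u \<in> ?V" for u i
      using y(2)[OF that, of i] by (simp add: w_def inner_diff_right)
    have sumw: "(\<Sum>i\<in>UNIV. w $ i) = 0"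
    proof -
      have S: "(\<Sum>i\<in>UNIV. w $ i) \<in> ?V" unfolding w_def using y(1) V by (auto intro: subspace_sum)
      have "(\<Sum>i\<in>UNIV. w $ i) \<bullet> (\<Sum>i\<in>UNIV. w $ i) = (\<Sum>i\<in>UNIV. w $ i) \<bullet> (\<Sum>i\<in>UNIV. v $ i)"
        unfolding inner_sum_right by (intro sum.cong refl inner_w S)
      then show ?thesis using v(2) by simp
    qed
    have lt: "w \<bullet> (a - z \<epsilon>) < 0" if a: "\<And>i. a $ i \<in> L" for a
    proof -
      have "w \<bullet> (a - z \<epsilon>) = v \<bullet> (a - z \<epsilon>)"
        unfolding inner_vec_def
      proof (intro sum.cong refl)
        fix i
        have "(a - z \<epsilon>) $ i \<in> ?V" using zV[OF a[of i], of \<epsilon> i] by simp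
        from inner_w[OF this] show "w $ i \<bullet> (a - z \<epsilon>) $ i = v $ i \<bullet> (a - z \<epsilon>) $ i"
          by (simp only: inner_commute)
      qed
      then show ?thesis using v(3)[OF a] by simp
    qed
    have w0: "w \<noteq> 0" using lt[of x] xL by auto
    have UV: "span U \<subseteq> ?V"
      using h V by (intro span_minimal) (auto simp: unit_normal_at_def normal_cone_def)
    have ew: "e \<bullet> w $ i = 0" for i
      using inner_w[of e i] e(1) UV e(3)[OF v(1)[of i]] by auto
    show ?thesis
    proof (intro bexI[of _ "(w /\<^sub>R norm w, e)"] allI impI)
      show "(w /\<^sub>R norm w, e) \<in> D"
        unfolding D_def using w0 e(1,2) ew sumw subspace_scale[OF V] y(1)
        by (auto simp: w_def simp flip: scaleR_sum_right)
      fix a :: "'a ^ 'i" assume "\<forall>i. a $ i \<in> L"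
      then have "w \<bullet> (a - z \<epsilon>) < 0" using lt by blast
      then show "fst (w /\<^sub>R norm w, e) \<bullet> (a - z \<epsilon>) < 0"
        using w0 by (simp add: mult_pos_neg)
    qed
  qed
  obtain q where q: "\<And>n. q n \<in> D"
      "\<And>n a. (\<And>i. a $ i \<in> L) \<Longrightarrow> fst (q n) \<bullet> (a - z (inverse (real (Suc n)))) < 0"
  proof -
    have "\<exists>q. q \<in> D \<and> (\<forall>a. (\<forall>i. a $ i \<in> L) \<longrightarrow> fst q \<bullet> (a - z (inverse (real (Suc n)))) < 0)" for n
      using ex[of "inverse (real (Suc n))"] by auto
    then show ?thesis using that by metis
  qed
  obtain l r where l: "l \<in> D" "strict_mono r" "(q \<circ> r) \<longlonglongrightarrow> l"
    using \<open>compact D\<close> q(1) unfolding compact_def by metis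
  obtain w e where we: "l = (w, e)" by force
  have le: "w \<bullet> (a - x) \<le> 0" if a: "\<And>i. a $ i \<in> L" for a
  proof -
    have "(\<lambda>n. inverse (real (Suc (r n)))) \<longlonglongrightarrow> 0"
      using LIMSEQ_subseq_LIMSEQ[OF LIMSEQ_inverse_real_of_nat l(2)] by (simp add: o_def)
    then have "(\<lambda>n. z (inverse (real (Suc (r n))))) \<longlonglongrightarrow> x + 0 *\<^sub>R (x - (\<chi> i. p))"
      unfolding z_def by (intro tendsto_intros)
    moreover have "(\<lambda>n. fst (q (r n))) \<longlonglongrightarrow> w"
      using tendsto_fst[OF l(3)] by (simp add: we o_def)
    ultimately have "(\<lambda>n. fst (q (r n)) \<bullet> (a - z (inverse (real (Suc (r n)))))) \<longlonglongrightarrow>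
        w \<bullet> (a - (x + 0 *\<^sub>R (x - (\<chi> i. p))))"
      by (intro tendsto_intros)
    then show ?thesis
      using q(2)[of a, OF a] by (intro LIMSEQ_le_const2) (auto intro: less_imp_le)
  qed
  have wD: "norm w = 1" "norm e = 1" "e \<in> span U" "\<And>i. w $ i \<in> ?V" "(\<Sum>i\<in>UNIV. w $ i) = 0"
    "\<And>i. e \<bullet> w $ i = 0"
    using l(1) unfolding we D_def by auto
  \<comment> \<open>Changing a single coordinate of \<open>x\<close> within \<open>L\<close> shows
    that \<open>w $ i\<close> is normal to \<open>L\<close> at \<open>x $ i\<close>, where
    regularity leaves only multiples of \<open>f i\<close>.\<close>
  have wf: "w $ i = norm (w $ i) *\<^sub>R f i" for i
  proof (rule normal_cone_regular_point[OF xn])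
    have "w $ i \<bullet> (y - x $ i) \<le> 0" if "y \<in> L" for y
    proof -
      let ?a = "\<chi> j. if j = i then y else x $ j"
      have "w \<bullet> (?a - x) = (\<Sum>j\<in>UNIV. if j = i then w $ i \<bullet> (y - x $ i) else 0)"
        unfolding inner_vec_def by (intro sum.cong) auto
      then have "w \<bullet> (?a - x) = w $ i \<bullet> (y - x $ i)" by simp
      moreover have "w \<bullet> (?a - x) \<le> 0" using that xL by (intro le) auto
      ultimately show ?thesis by simp
    qed
    then show "w $ i \<in> normal_cone L (x $ i)" unfolding normal_cone_def using wD(4) by blast
  qed
  \<comment> \<open>As \<open>f\<close> may repeat members, the weight of \<open>u\<close> collects
    its whole fibre.\<close>
  define b where "b u = (\<Sum>i | f i = u. norm (w $ i))" for u
  have "(\<Sum>u\<in>U. b u *\<^sub>R u) = (\<Sum>u\<in>U. \<Sum>i | i \<in> UNIV \<and> f i = u. w $ i)"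
    unfolding b_def scaleR_sum_left
  proof (intro sum.cong refl)
    show "norm (w $ i) *\<^sub>R u = w $ i" if "i \<in> {i \<in> UNIV. f i = u}" for i u
      using wf[of i] that by simp
  qed simp
  also have "\<dots> = (\<Sum>i\<in>UNIV. w $ i)" using fin f by (intro sum.group) auto
  finally have b0: "(\<Sum>u\<in>U. b u *\<^sub>R u) = 0" using wD(5) by simp
  obtain j where j: "w $ j \<noteq> 0" using wD(1) by (metis norm_zero vec_eq_iff zero_index zero_neq_one)
  have "norm (w $ j) \<le> b (f j)" unfolding b_def by (intro member_le_sum) auto
  then have bj: "b (f j) \<noteq> 0" using j by auto
  \<comment> \<open>One nonzero weight makes all weights positive, so every \<open>u\<close> is
    proportional to some nonzero \<open>w $ i\<close> and thus orthogonal to \<open>e\<close>,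
    although \<open>e\<close> is a unit vector of \<open>span U\<close>.\<close>
  have "e \<bullet> u = 0" if u: "u \<in> U" for u
  proof -
    have "b u > 0"
    proof (rule simplicial_relation_positive[OF U _ b0 _ bj u])
      show "b u \<ge> 0" for u unfolding b_def by (simp add: sum_nonneg)
      show "f j \<in> U" using f by blast
    qed
    have "\<exists>i. f i = u \<and> w $ i \<noteq> 0"
    proof (rule ccontr)
      assume "\<nexists>i. f i = u \<and> w $ i \<noteq> 0"
      then have "b u = 0" unfolding b_def by (auto intro: sum.neutral)
      then show False using \<open>b u > 0\<close> by simp
    qed
    then obtain i where i: "f i = u" "w $ i \<noteq> 0" by blast
    have "0 = e \<bullet> (norm (w $ i) *\<^sub>R f i)" using wD(6)[of i] wf[of i] by simp
    then show ?thesis using i by simp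
  qed
  then have "orthogonal e e"
    using wD(3) by (intro orthogonal_to_span[of e U e]) (auto simp: orthogonal_def)
  then show False using wD(2) by (simp add: orthogonal_def)
qed

theorem theorem4p4:
  fixes L :: "(real ^ 'n) set" and d :: nat
  assumes "CARD('n) \<ge> 2"
    and "1 \<le> d" and "d \<le> CARD('n) - 1"
    and "compact L" and "convex L" and "L \<noteq> {}"
  shows "reliable d L \<longleftrightarrow>
    (\<forall>U. simplicial_family U \<and> (\<forall>u\<in>U. \<exists>x. unit_normal_at L x u) \<longrightarrow> card U \<le> d + 1)"
proof
  assume rel: "reliable d L"
  show "\<forall>U. simplicial_family U \<and> (\<forall>u\<in>U. \<exists>x. unit_normal_at L x u) \<longrightarrow> card U \<le> d + 1"
  proof (intro allI impI, rule ccontr)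
    fix U :: "(real ^ 'n) set"
    assume *: "simplicial_family U \<and> (\<forall>u\<in>U. \<exists>x. unit_normal_at L x u)" "\<not> card U \<le> d + 1"
    then obtain k where k: "k_simplicial_family k U" unfolding simplicial_family_def by blast
    then have fin: "finite U" and card: "card U = k + 1" and "dim (span U) = k"
      unfolding k_simplicial_family_def by auto
    then have "k \<le> CARD('n)" using dim_subset_UNIV[of "span U"] by simp
    \<comment> \<open>\<open>U\<close> has at most \<open>CARD('n) + 1\<close> members, the
      cardinality of \<open>'n option\<close>; indices not hit by \<open>h\<close> on
      \<open>U\<close> will get the default \<open>u0\<close>.\<close>
    then have "card U \<le> card (UNIV :: 'n option set)" using card by (simp add: card_UNIV_option)
    then obtain h :: "real ^ 'n \<Rightarrow> 'n option" where h: "inj_on h U"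
      using card_le_inj[OF fin finite] by blast
    obtain u0 where "u0 \<in> U" using card by fastforce
    define f where "f i = (if i \<in> h ` U then inv_into U h i else u0)" for i
    have "range f = U"
    proof
      show "range f \<subseteq> U" using \<open>u0 \<in> U\<close> by (auto simp: f_def inv_into_into)
      show "U \<subseteq> range f"
      proof
        fix u assume "u \<in> U"
        then have "f (h u) = u" using h by (simp add: f_def)
        then show "u \<in> range f" by (metis rangeI)
      qed
    qed
    moreover have "d < k" using *(2) card by simp
    ultimately show False
      using not_reliable_if_simplicial_family_large[OF assms(4-6) k, of d f] *(1) rel by blast
  qed
next
  assume fam: "\<forall>U. simplicial_family U \<and> (\<forall>u\<in>U. \<exists>x. unit_normal_at L x u) \<longrightarrow> card U \<le> d + 1"
  have "d \<le> DIM(real ^ 'n)" using assms(3) by simp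
  from reliable_if_simplicial_families_small[OF assms(4-6,2) this]
  show "reliable d L" using fam by blast
qed

end
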